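(* Let $D$ be a finite twin-free digraph. If $\overrightarrow{\gamma^{\mathrm{ID}}}(D)=|V(D)|$, then $D\in(K_1,\oplus,\overrightarrow{\triangleleft})$.
   Context: Digraphs have no loops or multiple arcs; an arc from $u$ to $v$ is written $\overrightarrow{uv}$. For a vertex $u$, $B_1^+(u)$ is the set consisting of $u$ and all $w$ with $\overrightarrow{wu}$ an arc. Vertices $u\neq v$ are twins if $B_1^+(u)=B_1^+(v)$; $D$ is twin-free if it has no twins. An identifying code of $D$ is a set $C\subseteq V(D)$ such that $B_1^+(u)\cap C\neq\emptyset$ for all $u$ and $B_1^+(u)\cap C\neq B_1^+(v)\cap C$ for all distinct $u,v$; $\overrightarrow{\gamma^{\mathrm{ID}}}(D)$ is the minimum size of an identifying code. For digraphs $D_1,D_2$ on disjoint vertex sets, $D_1\oplus D_2$ is their disjoint union. For a digraph $D$ and a new vertex $x$, $x\overrightarrow{\triangleleft}(D)$ is obtained from $D$ by adding $x$ and all arcs $\overrightarrow{xv}$, $v\in V(D)$. $(K_1,\oplus,\overrightarrow{\triangleleft})$ denotes the class of all digraphs that can be built from the one-vertex digraph $K_1$ by repeated applications of $\oplus$ and $\overrightarrow{\triangleleft}$ (up to isomorphism). *)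

theory Defs
  imports "Graph_Theory.Pair_Digraph"
begin

text \<open>
  The superscript plus in the name of this ball refers to the arcs entering \<open>u\<close>: the vertex \<open>u\<close>
  is covered by itself and by its in-neighbours.
\<close>

definition ball_plus :: "'a pair_pre_digraph \<Rightarrow> 'a \<Rightarrow> 'a set" where
  "ball_plus D u = insert u {w. (w, u) \<in> parcs D}"

definition twins :: "'a pair_pre_digraph \<Rightarrow> 'a \<Rightarrow> 'a \<Rightarrow> bool" where
  "twins D u v \<longleftrightarrow> u \<noteq> v \<and> ball_plus D u = ball_plus D v"

definition twin_free :: "'a pair_pre_digraph \<Rightarrow> bool" where
  "twin_free D \<longleftrightarrow> \<not> (\<exists>u\<in>pverts D. \<exists>v\<in>pverts D. twins D u v)"

definition identifying_code :: "'a pair_pre_digraph \<Rightarrow> 'a set \<Rightarrow> bool" where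
  "identifying_code D C \<longleftrightarrow> C \<subseteq> pverts D \<and>
     (\<forall>u\<in>pverts D. ball_plus D u \<inter> C \<noteq> {}) \<and>
     (\<forall>u\<in>pverts D. \<forall>v\<in>pverts D. u \<noteq> v \<longrightarrow> ball_plus D u \<inter> C \<noteq> ball_plus D v \<inter> C)"

text \<open>
  A finite digraph has an identifying code iff it is twin-free; otherwise the value below is
  unspecified.
\<close>

definition gamma_ID :: "'a pair_pre_digraph \<Rightarrow> nat" where
  "gamma_ID D = (LEAST k. \<exists>C. identifying_code D C \<and> finite C \<and> card C = k)"

definition single_vertex :: "'a \<Rightarrow> 'a pair_pre_digraph" where
  "single_vertex x = \<lparr> pverts = {x}, parcs = {} \<rparr>"

text \<open>
  These two operations are meant for disjoint vertex sets and for a new vertex \<open>x\<close>, respectively;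
  this is imposed where they are used.
\<close>

definition digraph_sum :: "'a pair_pre_digraph \<Rightarrow> 'a pair_pre_digraph \<Rightarrow> 'a pair_pre_digraph" where
  "digraph_sum D1 D2 = \<lparr> pverts = pverts D1 \<union> pverts D2, parcs = parcs D1 \<union> parcs D2 \<rparr>"

definition add_source :: "'a \<Rightarrow> 'a pair_pre_digraph \<Rightarrow> 'a pair_pre_digraph" where
  "add_source x D = \<lparr> pverts = insert x (pverts D), parcs = parcs D \<union> {x} \<times> pverts D \<rparr>"

text \<open>
  No rule for isomorphic copies is needed: the vertex names in the construction are arbitrary, and
  \<open>K1_class_iso\<close> below shows that the class is closed under isomorphism, also across vertex types.
\<close>

inductive K1_class :: "'a pair_pre_digraph \<Rightarrow> bool" where
  K1: "K1_class (single_vertex x)"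
| sum: "\<lbrakk> K1_class D1; K1_class D2; pverts D1 \<inter> pverts D2 = {} \<rbrakk> \<Longrightarrow> K1_class (digraph_sum D1 D2)"
| source: "\<lbrakk> K1_class D; x \<notin> pverts D \<rbrakk> \<Longrightarrow> K1_class (add_source x D)"

lemma K1_class_pair_digraph:
  assumes "K1_class D"
  shows "pair_digraph D" and "pverts D \<noteq> {}"
proof -
  have "pair_digraph D \<and> pverts D \<noteq> {}"
    using assms
  proof induction
    case (K1 x)
    show ?case
      by (simp add: single_vertex_def, unfold_locales) auto
  next
    case (sum D1 D2)
    then interpret D1: pair_digraph D1 by simp
    interpret D2: pair_digraph D2 using sum by simp
    have "pair_digraph (digraph_sum D1 D2)"
      by unfold_locales
        (auto simp: digraph_sum_def dest: D1.in_arcsD1 D1.in_arcsD2 D2.in_arcsD1 D2.in_arcsD2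
          D1.no_loops' D2.no_loops')
    then show ?case using sum by (simp add: digraph_sum_def)
  next
    case (source D x)
    then interpret pair_digraph D by simp
    have "pair_digraph (add_source x D)"
      using source.hyps
      by unfold_locales
        (auto simp: add_source_def dest: in_arcsD1 in_arcsD2 no_loops')
    then show ?case by (simp add: add_source_def)
  qed
  then show "pair_digraph D" and "pverts D \<noteq> {}" by simp_all
qed

lemma K1_class_iso:
  fixes D :: "'a pair_pre_digraph" and f :: "'a \<Rightarrow> 'b"
  assumes "K1_class D" and "inj_on f (pverts D)"
  shows "K1_class \<lparr> pverts = f ` pverts D, parcs = map_prod f f ` parcs D \<rparr>"
  using assms
proof induction
  case (K1 x)
  then show ?case using K1_class.K1[of "f x"] by (simp add: single_vertex_def)
next
  case (sum D1 D2)
  have "f ` pverts D1 \<inter> f ` pverts D2 = {}"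
    using sum.hyps(3) sum.prems by (auto simp: digraph_sum_def inj_on_def)
  moreover have "inj_on f (pverts D1)" "inj_on f (pverts D2)"
    using sum.prems by (auto simp: digraph_sum_def inj_on_Un)
  ultimately show ?case
    using K1_class.sum[OF sum.IH] by (simp add: digraph_sum_def image_Un)
next
  case (source D x)
  have "f x \<notin> f ` pverts D" "inj_on f (pverts D)"
    using source.hyps(2) source.prems by (auto simp: add_source_def)
  then have "K1_class (add_source (f x) \<lparr> pverts = f ` pverts D, parcs = map_prod f f ` parcs D \<rparr>)"
    using K1_class.source source.IH by fastforce
  moreover have "map_prod f f ` ({x} \<times> pverts D) = {f x} \<times> f ` pverts D" by force
  ultimately show ?case by (simp add: add_source_def image_Un)
qed

end

theory Submission
  imports Defs
begin

text \<open>
  Let \<open>V\<close> be the vertex set, \<open>n = card V\<close>, and let \<open>F\<close> consist of the \<open>n\<close> balls and the empty set.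
  Minimality of the code \<open>V\<close> means that every vertex \<open>x\<close> is the unique difference of two members
  of \<open>F\<close>. Deleting a vertex from all members of \<open>F\<close> therefore merges two of them, so \<open>F\<close>, which
  has at most \<open>n + 1\<close> members, leaves at most three traces on any pair of vertices. If \<open>M\<close> and
  \<open>M - {x}\<close> are the two members of \<open>F\<close> differing in \<open>x\<close>, this forces \<open>M\<close> to be the least member of
  \<open>F\<close> containing \<open>x\<close>. So \<open>M\<close> is a ball contained in the ball of \<open>x\<close>, different \<open>x\<close> give different
  balls, and summing cardinalities shows that \<open>M\<close> is the ball of \<open>x\<close> itself. Hence the arcs form a
  strict order in which the predecessors of each vertex form a chain, and such a digraph is
  decomposed by splitting off a component or, if there is only one, its root.
\<close>

section \<open>Traces of set families\<close>

text \<open>Induction on \<open>T\<close>: removing a further \<open>x\<close> identifies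
  \<open>A - T\<close> with \<open>insert x A - T\<close>, which differ because \<open>x\<close> is
  not in \<open>T\<close>. Each deletion thus loses at least one trace.\<close>

lemma card_trace_add_card_le:
  assumes "finite T" and "finite F"
    and "\<forall>x\<in>T. \<exists>A\<in>F. x \<notin> A \<and> insert x A \<in> F"
  shows "card ((\<lambda>A. A - T) ` F) + card T \<le> card F"
  using assms(1,3)
proof (induction T rule: finite_induct)
  case empty
  then show ?case by simp
next
  case (insert x T)
  define G where "G = (\<lambda>A. A - T) ` F"
  have fin: "finite G" using assms(2) by (simp add: G_def)
  obtain A where A: "A \<in> F" "x \<notin> A" "insert x A \<in> F" using insert.prems by blast
  have "A - T \<in> G" "insert x A - T \<in> G" using A unfolding G_def by blast+
  moreover have "A - T \<noteq> insert x A - T" using A(2) insert.hyps(2) by blast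
  moreover have "A - T - {x} = insert x A - T - {x}" by blast
  ultimately have "\<not> inj_on (\<lambda>A. A - {x}) G" unfolding inj_on_def by blast
  then have "card ((\<lambda>A. A - {x}) ` G) < card G"
    using fin by (metis card_image_le eq_card_imp_inj_on le_neq_implies_less)
  moreover have "(\<lambda>A. A - insert x T) ` F = (\<lambda>A. A - {x}) ` G"
    unfolding G_def image_image by (rule image_cong) auto
  ultimately show ?case
    using insert by (simp add: G_def)
qed

text \<open>A point \<open>y\<close> of \<open>M\<close> outside \<open>A\<close> would let
  \<open>{}\<close>, \<open>A\<close>, \<open>M\<close> and \<open>insert x M\<close> leave all four
  traces on \<open>{x, y}\<close>, one more than the trace bound allows.\<close>

lemma insert_edge_subset:
  assumes "finite V" and "finite F" and "card F \<le> card V + 1"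
    and "\<Union>F \<subseteq> V" and "{} \<in> F"
    and edge: "\<forall>x\<in>V. \<exists>A\<in>F. x \<notin> A \<and> insert x A \<in> F"
    and M: "M \<in> F" "insert x M \<in> F" "x \<notin> M"
    and A: "A \<in> F" "x \<in> A"
  shows "insert x M \<subseteq> A"
proof (rule ccontr)
  assume "\<not> insert x M \<subseteq> A"
  then obtain y where y: "y \<in> M" "y \<notin> A" using A by blast
  \<comment> \<open>Deleting all vertices but \<open>x\<close> and \<open>y\<close> turns each
    member of \<open>F\<close> into its trace on this pair.\<close>
  define T where "T = V - {x, y}"
  have xy: "x \<in> V" "y \<in> V" "x \<noteq> y" using y M A assms(4) by blast+
  have "card T + 2 = card V"
    using card_Diff_subset[of "{x, y}" V] card_mono[of V "{x, y}"] xy assms(1)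
    by (simp add: T_def)
  moreover have "card ((\<lambda>A. A - T) ` F) + card T \<le> card F"
    by (rule card_trace_add_card_le) (use assms(1,2) edge in \<open>auto simp: T_def\<close>)
  ultimately have "card ((\<lambda>A. A - T) ` F) \<le> 3" using assms(3) by linarith
  moreover have "{{}, {x}, {y}, {x, y}} \<subseteq> (\<lambda>A. A - T) ` F"
  proof -
    have "{} - T = {}" "A - T = {x}" "M - T = {y}" "insert x M - T = {x, y}"
      using y M A xy assms(4) by (auto simp: T_def)
    then show ?thesis
      using assms(5) M A by (metis (no_types, lifting) empty_subsetI image_eqI insert_subsetI)
  qed
  then have "card {{}, {x}, {y}, {x, y}} \<le> card ((\<lambda>A. A - T) ` F)"
    by (intro card_mono finite_imageI assms(2))
  moreover have "card {{}, {x}, {y}, {x, y}} = 4" using xy by (auto simp: card_insert_if)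
  ultimately show False by linarith
qed

text \<open>As \<open>g\<close> permutes \<open>V\<close>, both sides have the same sum over
  \<open>V\<close>, so no single inequality can be strict.\<close>

lemma finite_permutation_le_imp_eq:
  fixes c :: "'a \<Rightarrow> nat"
  assumes "finite V" and "g ` V \<subseteq> V" and "inj_on g V"
    and "\<And>x. x \<in> V \<Longrightarrow> c (g x) \<le> c x" and "x \<in> V"
  shows "c (g x) = c x"
proof -
  have "bij_betw g V V"
    using assms(1-3) by (simp add: bij_betw_def endo_inj_surj)
  then have "(\<Sum>x\<in>V. c (g x)) = (\<Sum>x\<in>V. c x)" by (rule sum.reindex_bij_betw)
  then show ?thesis using sum_mono_inv[of "\<lambda>x. c (g x)" V c] assms by blast
qed

section \<open>Transitive closures of rooted forests\<close>

lemma pair_digraph_restrict: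
  assumes "pair_digraph D"
  shows "pair_digraph \<lparr> pverts = pverts D \<inter> U, parcs = parcs D \<inter> U \<times> U \<rparr>"
proof -
  interpret pair_digraph D by fact
  show ?thesis
    by unfold_locales (auto dest: in_arcsD1 in_arcsD2 no_loops')
qed

text \<open>Induction on the number of vertices. A minimal vertex \<open>r\<close> together with its
  out-neighbours is either a proper part that splits off as a summand, or everything, and then
  \<open>r\<close> is an added source.\<close>

lemma K1_class_if_forest_order:
  assumes "pair_digraph D" and "pverts D \<noteq> {}" and "trans (parcs D)"
    and "\<And>u v w. (u, w) \<in> parcs D \<Longrightarrow> (v, w) \<in> parcs D \<Longrightarrow>
      u = v \<or> (u, v) \<in> parcs D \<or> (v, u) \<in> parcs D"
  shows "K1_class D"
  using assms
proof (induction "card (pverts D)" arbitrary: D rule: less_induct)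
  case less
  interpret pair_digraph D by fact
  define R where "R U = \<lparr> pverts = pverts D \<inter> U, parcs = parcs D \<inter> U \<times> U \<rparr>" for U
  note [dest] = in_arcsD1 in_arcsD2 no_loops'
  have IH: "K1_class (R U)" if "pverts D \<inter> U \<noteq> {}" "\<not> pverts D \<subseteq> U" for U
  proof (rule less.hyps)
    show "card (pverts (R U)) < card (pverts D)"
      unfolding R_def by simp (rule psubset_card_mono, use that in auto)
    show "pair_digraph (R U)" unfolding R_def by (rule pair_digraph_restrict) fact
    show "pverts (R U) \<noteq> {}" using that by (simp add: R_def)
    show "trans (parcs (R U))" using less.prems(3) by (auto simp: R_def trans_def)
    show "u = v \<or> (u, v) \<in> parcs (R U) \<or> (v, u) \<in> parcs (R U)"
      if "(u, w) \<in> parcs (R U)" "(v, w) \<in> parcs (R U)" for u v w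
      using that less.prems(4)[of u w v] by (auto simp: R_def)
  qed
  have "acyclic (parcs D)"
    using less.prems(3) by (auto simp: acyclic_def)
  then have "wf (parcs D)" by (intro finite_acyclic_wf) simp_all
  then obtain r where r: "r \<in> pverts D" "\<And>y. (y, r) \<notin> parcs D"
    using less.prems(2) by (metis wf_eq_minimal ex_in_conv in_arcsD1)
  define U where "U = insert r {u. (r, u) \<in> parcs D}"
  have U: "U \<subseteq> pverts D" using r by (auto simp: U_def)
  \<comment> \<open>No arc leaves \<open>U\<close> by transitivity. None enters it: if
    \<open>v\<close> is in \<open>U\<close>, then \<open>r\<close> and \<open>u\<close> both precede
    \<open>v\<close> or \<open>u = r\<close>, so they are equal or joined by an arc, which cannot
    end in \<open>r\<close>.\<close>
  have sep: "u \<in> U \<longleftrightarrow> v \<in> U" if "(u, v) \<in> parcs D" for u v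
    using that r(2) less.prems(4)[of r v u] transD[OF less.prems(3), of r u v]
    by (auto simp: U_def)
  consider "\<not> pverts D \<subseteq> U" | "pverts D = {r}" | "pverts D = U" "pverts D \<noteq> {r}"
    using U by blast
  then show ?case
  proof cases
    case 1
    have "K1_class (R U)" "K1_class (R (- U))"
      using 1 r(1) by (auto intro!: IH simp: U_def)
    then have "K1_class (digraph_sum (R U) (R (- U)))"
      by (rule K1_class.sum) (auto simp: R_def)
    moreover have "digraph_sum (R U) (R (- U)) = D"
      by (rule pair_pre_digraph.equality) (use sep in \<open>auto simp: R_def digraph_sum_def\<close>)
    ultimately show ?thesis by simp
  next
    case 2
    have "(a, b) \<notin> parcs D" for a b
      using 2 r(2) in_arcsD2[of a b] by auto
    then have "D = single_vertex r"
      by (intro pair_pre_digraph.equality) (use 2 in \<open>auto simp: single_vertex_def\<close>)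
    then show ?thesis by (simp add: K1_class.K1)
  next
    case 3
    have "K1_class (R (- {r}))" using 3 r(1) by (intro IH) auto
    then have "K1_class (add_source r (R (- {r})))"
      by (rule K1_class.source) (simp add: R_def)
    moreover have "add_source r (R (- {r})) = D"
    proof (rule pair_pre_digraph.equality)
      show "parcs (add_source r (R (- {r}))) = parcs D"
        using 3(1) r by (auto simp: add_source_def R_def U_def)
    qed (use r in \<open>auto simp: add_source_def R_def\<close>)
    ultimately show ?thesis by simp
  qed
qed

section \<open>Balls of extremal digraphs\<close>

lemma ball_plus_subset_pverts:
  assumes "pair_digraph D" and "u \<in> pverts D"
  shows "ball_plus D u \<subseteq> pverts D"
proof -
  interpret pair_digraph D by fact
  show ?thesis using assms(2) by (auto simp: ball_plus_def dest: in_arcsD1)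
qed

text \<open>Without \<open>x\<close> the full vertex set is no code. Either some ball is just
  \<open>{x}\<close>, paired here with the empty set, or two balls differ exactly in
  \<open>x\<close>.\<close>

lemma edge_of_extremal:
  assumes "pair_digraph D" and "twin_free D" and "gamma_ID D = card (pverts D)"
    and x: "x \<in> pverts D"
  shows "\<exists>A\<in>insert {} (ball_plus D ` pverts D).
    x \<notin> A \<and> insert x A \<in> insert {} (ball_plus D ` pverts D)"
proof -
  interpret pair_digraph D by fact
  let ?C = "pverts D - {x}"
  have "\<not> identifying_code D ?C"
  proof
    assume "identifying_code D ?C"
    then have "gamma_ID D \<le> card ?C"
      unfolding gamma_ID_def by (intro Least_le exI[of _ ?C]) simp
    moreover have "card ?C < card (pverts D)" using x by (intro psubset_card_mono) auto
    ultimately show False using assms(3) by simp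
  qed
  then consider u where "u \<in> pverts D" "ball_plus D u \<inter> ?C = {}"
    | u v where "u \<in> pverts D" "v \<in> pverts D" "u \<noteq> v" "ball_plus D u \<inter> ?C = ball_plus D v \<inter> ?C"
    unfolding identifying_code_def by blast
  then show ?thesis
  proof cases
    case 1
    then have "ball_plus D u = {x}"
      using ball_plus_subset_pverts[OF assms(1), of u] by (auto simp: ball_plus_def)
    then show ?thesis using 1 by (intro bexI[of _ "{}"]) force+
  next
    case 2
    have ne: "ball_plus D u \<noteq> ball_plus D v"
      using 2 assms(2) by (auto simp: twin_free_def twins_def)
    have eq: "ball_plus D u - {x} = ball_plus D v - {x}"
      using 2 ball_plus_subset_pverts[OF assms(1)] by blast
    show ?thesis
    proof (cases "x \<in> ball_plus D u")
      case True
      then have "x \<notin> ball_plus D v" "insert x (ball_plus D v) = ball_plus D u"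
        using ne eq by blast+
      then show ?thesis using 2 by (intro bexI[of _ "ball_plus D v"]) auto
    next
      case False
      then have "insert x (ball_plus D u) = ball_plus D v"
        using ne eq by blast
      then show ?thesis using 2 False by (intro bexI[of _ "ball_plus D u"]) auto
    qed
  qed
qed

lemma ball_plus_of_extremal:
  assumes "pair_digraph D" and "twin_free D" and "gamma_ID D = card (pverts D)"
    and x: "x \<in> pverts D"
  shows "ball_plus D x - {x} \<in> insert {} (ball_plus D ` pverts D)"
    and "\<And>u. u \<in> pverts D \<Longrightarrow> x \<in> ball_plus D u \<Longrightarrow> ball_plus D x \<subseteq> ball_plus D u"
proof -
  interpret pair_digraph D by fact
  define F where "F = insert {} (ball_plus D ` pverts D)"
  have edge: "\<forall>x\<in>pverts D. \<exists>A\<in>F. x \<notin> A \<and> insert x A \<in> F"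
    using edge_of_extremal[OF assms(1-3)] by (simp add: F_def)
  then obtain M where M: "\<And>x. x \<in> pverts D \<Longrightarrow> M x \<in> F \<and> x \<notin> M x \<and> insert x (M x) \<in> F"
    by metis
  have "card F \<le> card (pverts D) + 1"
    unfolding F_def using card_image_le[of "pverts D" "ball_plus D"]
    by (simp add: card_insert_if)
  moreover have "\<Union>F \<subseteq> pverts D"
    using ball_plus_subset_pverts[OF assms(1)] by (auto simp: F_def)
  ultimately have least: "insert x (M x) \<subseteq> A" if "x \<in> pverts D" "A \<in> F" "x \<in> A" for x A
    using that edge M[OF that(1)] by (intro insert_edge_subset[of "pverts D" F]) (auto simp: F_def)
  have "\<exists>g. \<forall>x\<in>pverts D. g x \<in> pverts D \<and> ball_plus D (g x) = insert x (M x)"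
  proof (intro bchoice ballI)
    show "\<exists>y. y \<in> pverts D \<and> ball_plus D y = insert x (M x)" if "x \<in> pverts D" for x
      using M[OF that] unfolding F_def by force
  qed
  then obtain g where g: "\<And>x. x \<in> pverts D \<Longrightarrow> g x \<in> pverts D"
    and ball_g: "\<And>x. x \<in> pverts D \<Longrightarrow> ball_plus D (g x) = insert x (M x)"
    by blast
  have sub: "ball_plus D (g x) \<subseteq> ball_plus D x" if "x \<in> pverts D" for x
    unfolding ball_g[OF that] using that by (intro least) (auto simp: F_def ball_plus_def)
  \<comment> \<open>If \<open>x\<close> and \<open>y\<close> shared the ball, \<open>M x\<close>
    would be a member of \<open>F\<close> containing \<open>y\<close>, hence would contain the whole
    ball and with it \<open>x\<close>.\<close>
  have inj: "inj_on g (pverts D)"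
  proof (rule inj_onI, rule ccontr)
    fix x y assume xy: "x \<in> pverts D" "y \<in> pverts D" "g x = g y" "x \<noteq> y"
    then have eq: "insert x (M x) = insert y (M y)" using ball_g by metis
    moreover have "y \<in> M x" using equalityD2[OF eq] xy(4) by simp
    ultimately have "insert y (M y) \<subseteq> M x" using xy M by (intro least) auto
    then show False using eq M xy by blast
  qed
  have ball: "ball_plus D x = insert x (M x)" if "x \<in> pverts D" for x
  proof -
    have fin: "finite (ball_plus D x)" if "x \<in> pverts D" for x
      by (rule finite_subset[OF ball_plus_subset_pverts[OF assms(1) that]]) simp
    have "card (ball_plus D (g x)) = card (ball_plus D x)"
    proof (rule finite_permutation_le_imp_eq[of "pverts D" g "\<lambda>x. card (ball_plus D x)"])
      show "card (ball_plus D (g x)) \<le> card (ball_plus D x)" if "x \<in> pverts D" for x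
        using card_mono[OF fin sub] that by blast
    qed (use g inj that in auto)
    then show ?thesis
      using card_subset_eq[OF fin[OF that] sub[OF that]] ball_g[OF that] by simp
  qed
  show "ball_plus D x - {x} \<in> insert {} (ball_plus D ` pverts D)"
    using ball[OF x] M[OF x] by (simp add: F_def)
  show "ball_plus D x \<subseteq> ball_plus D u" if "u \<in> pverts D" "x \<in> ball_plus D u" for u
    unfolding ball[OF x] using that x by (intro least) (auto simp: F_def)
qed

theorem theorem3:
  fixes D :: "'a pair_pre_digraph"
  assumes "pair_digraph D"
    and "pverts D \<noteq> {}"
    and "twin_free D"
    and "gamma_ID D = card (pverts D)"
  shows "K1_class D"
proof (rule K1_class_if_forest_order[OF assms(1,2)])
  interpret pair_digraph D by fact
  note mono = ball_plus_of_extremal(2)[OF assms(1,3,4)]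
  show "trans (parcs D)"
  proof (rule transI)
    fix a b c assume ab: "(a, b) \<in> parcs D" and bc: "(b, c) \<in> parcs D"
    have V: "a \<in> pverts D" "b \<in> pverts D" "c \<in> pverts D"
      using ab bc by (auto dest: in_arcsD1 in_arcsD2)
    have sub: "ball_plus D b \<subseteq> ball_plus D c"
      using bc V by (intro mono) (auto simp: ball_plus_def)
    show "(a, c) \<in> parcs D"
    \<comment> \<open>For \<open>a = c\<close> the two opposite arcs make the balls of
      \<open>b\<close> and \<open>c\<close> equal, and twin-freeness applies.\<close>
    proof (cases "a = c")
      case True
      then have "ball_plus D c \<subseteq> ball_plus D b"
        using ab V by (intro mono) (auto simp: ball_plus_def)
      then have "b = c" using sub V assms(3) by (auto simp: twin_free_def twins_def)
      then show ?thesis using ab by simp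
    next
      case False
      then show ?thesis using sub ab by (auto simp: ball_plus_def)
    qed
  qed
  \<comment> \<open>Descent along balls: if neither vertex is \<open>w\<close>, both lie in the ball
    of \<open>w\<close> without \<open>w\<close>. This set is nonempty, hence again a ball, and it
    is smaller.\<close>
  have chain: "u \<in> ball_plus D v \<or> v \<in> ball_plus D u"
    if "w \<in> pverts D" "u \<in> ball_plus D w" "v \<in> ball_plus D w" for u v w
    using that
  proof (induction "card (ball_plus D w)" arbitrary: w rule: less_induct)
    case less
    show ?case
    proof (cases "u = w \<or> v = w")
      case True
      then show ?thesis using less.prems by auto
    next
      case False
      then have "u \<in> ball_plus D w - {w}" "v \<in> ball_plus D w - {w}" using less.prems by auto
      moreover from this obtain p where "p \<in> pverts D" and p: "ball_plus D w - {w} = ball_plus D p"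
        using ball_plus_of_extremal(1)[OF assms(1,3,4) less.prems(1)] by auto
      moreover have "card (ball_plus D p) < card (ball_plus D w)"
        unfolding p[symmetric]
        using finite_subset[OF ball_plus_subset_pverts[OF assms(1) less.prems(1)]]
        by (intro card_Diff1_less) (auto simp: ball_plus_def)
      ultimately show ?thesis using less.hyps[of p] by metis
    qed
  qed
  show "u = v \<or> (u, v) \<in> parcs D \<or> (v, u) \<in> parcs D"
    if "(u, w) \<in> parcs D" "(v, w) \<in> parcs D" for u v w
    using chain[of w u v] that in_arcsD2[OF that(1)] by (auto simp: ball_plus_def)
qed

end
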